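(* For every integer $n\geq 1$, \[ S(n)\leq \pi n . \]
   Context: Let $\overline{\mathbb D}=\{z\in\mathbb C:|z|\le 1\}$ and $\partial\mathbb D=\{z\in\mathbb C:|z|=1\}$. For $n\ge 1$ let $\mathcal P_n$ be the class of monic polynomials $f(z)=\prod_{j=1}^n(z-a_j)$ of degree $n$ all of whose zeros satisfy $|a_j|\le 1$. For $f\in\mathcal P_n$ put $E_f=\{z\in\mathbb C:|z|\le 1,\ |f(z)|\le 1\}$ (note $0\in E_f$). Define \[ S(n)=\sup_{f\in\mathcal P_n}\ \inf\{\ell(\gamma):\gamma\subset E_f,\ \gamma(0)=0,\ \gamma(1)\in\partial\mathbb D\}, \] where the infimum is over rectifiable paths, i.e. continuous maps $\gamma:[0,1]\to E_f$ of finite length $\ell(\gamma)$ with $\gamma(0)=0$ and $\gamma(1)\in\partial\mathbb D$; if no such path exists the infimum is interpreted as $+\infty$. *)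

theory Defs
  imports "HOL-Analysis.Analysis" "HOL-Computational_Algebra.Polynomial"
begin

(* The length of a curve on {0..1} as the supremum, over all finite increasing sequences of
   parameters, of the lengths of the inscribed polygons; it is top if the curve is not
   rectifiable.  The sequence need not contain 0 and 1 nor be strictly increasing: by the
   triangle inequality this does not change the supremum. *)
definition curve_length :: "(real \<Rightarrow> 'a::metric_space) \<Rightarrow> ennreal" where
  "curve_length \<gamma> =
     Sup {ennreal (\<Sum>i<N. dist (\<gamma> (t i)) (\<gamma> (t (Suc i)))) | N t.
            mono_on {..N} t \<and> t ` {..N} \<subseteq> {0..1}}"

definition rectifiable_path :: "(real \<Rightarrow> 'a::metric_space) \<Rightarrow> bool" where
  "rectifiable_path \<gamma> \<longleftrightarrow> path \<gamma> \<and> curve_length \<gamma> < top"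

definition disc_polys :: "nat \<Rightarrow> complex poly set" where
  "disc_polys n = {\<Prod>j=1..n. [:- a j, 1:] | a. \<forall>j\<in>{1..n}. cmod (a j) \<le> 1}"

definition disc_lemniscate :: "complex poly \<Rightarrow> complex set" where
  "disc_lemniscate f = {z. cmod z \<le> 1 \<and> cmod (poly f z) \<le> 1}"

definition escape_paths :: "complex poly \<Rightarrow> (real \<Rightarrow> complex) set" where
  "escape_paths f = {\<gamma>. rectifiable_path \<gamma> \<and> path_image \<gamma> \<subseteq> disc_lemniscate f \<and>
                        pathstart \<gamma> = 0 \<and> pathfinish \<gamma> \<in> sphere 0 1}"

(* Lengths live in ennreal, where the infimum over the empty set is top. *)
definition S :: "nat \<Rightarrow> ennreal" where
  "S n = (SUP f\<in>disc_polys n. INF \<gamma>\<in>escape_paths f. curve_length \<gamma>)"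

end

theory Submission
  imports Defs "HOL-Computational_Algebra.Fundamental_Theorem_Algebra"
begin

text \<open>
  Let \<open>f = (z - a\<^sub>1) \<cdots> (z - a\<^sub>n)\<close> with all \<open>a\<^sub>j\<close> in the closed unit disc, and reflect its zeros
  in the unit circle: \<open>q = (1 - cnj a\<^sub>1 z) \<cdots> (1 - cnj a\<^sub>n z)\<close>.  Then \<open>|f| \<le> |q|\<close> on the closed disc,
  \<open>q 0 = 1\<close>, and \<open>q\<close> has no zero in the open disc.  So it suffices to leave the disc along a short
  path on which \<open>|q| \<le> 1\<close>.

  Such a path is obtained by letting \<open>q\<close> decrease from \<open>1\<close> to \<open>0\<close> along the real axis: a nonconstant
  polynomial lifts every path, even through critical points (\<open>poly_lift_path\<close>), so there is a
  continuous \<open>z\<close> with \<open>z 0 = 0\<close> and \<open>q (z t) = 1 - t\<close>.  It ends at a zero of \<open>q\<close>, hence outside the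
  open disc, and is cut off where it first meets the circle.

  The length is bounded by Crofton's argument (\<open>curve_length_le_Crofton\<close>): a curve in the unit disc
  that in each direction meets all but finitely many lines in at most \<open>n\<close> points, counted by
  parameter, has length at most \<open>\<pi> n\<close>.  The curve is injective,
  since \<open>q\<close> takes different values along it, and lies in \<open>Im q = 0\<close>.  Restricted to a line, \<open>Im q\<close>
  is a real polynomial of degree at most \<open>n\<close> in the position on the line, so it has at most \<open>n\<close>
  zeros there unless it vanishes on the whole line; in each direction only finitely many lines do
  that (\<open>line_meets_real_preimage_finitely\<close>).
\<close>

section \<open>Lifting paths through polynomials\<close>

text \<open>
  A chain with steps at most \<open>\<delta>\<close> cannot travel far inside few balls of radius \<open>\<delta>\<close>, however many
  steps it makes: jump to the last visit to the ball of the starting point, at distance at most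
  \<open>2 * \<delta>\<close>, take one more step, and never see that ball again.
\<close>

lemma dist_le_chain_in_balls:
  fixes z :: "nat \<Rightarrow> 'a::metric_space"
  assumes "finite R" and "i \<le> j" and "\<delta> \<ge> 0"
    and "\<And>k. i \<le> k \<Longrightarrow> k \<le> j \<Longrightarrow> \<exists>r\<in>R. dist (z k) r \<le> \<delta>"
    and "\<And>k. i \<le> k \<Longrightarrow> k < j \<Longrightarrow> dist (z k) (z (Suc k)) \<le> \<delta>"
  shows "dist (z i) (z j) \<le> 3 * \<delta> * card R"
  using assms
proof (induction "card R" arbitrary: R i)
  case 0
  then show ?case by fastforce
next
  case (Suc n)
  obtain r where r: "r \<in> R" "dist (z i) r \<le> \<delta>"
    using Suc.prems(2,4) by blast
  define A where "A = {k. i \<le> k \<and> k \<le> j \<and> dist (z k) r \<le> \<delta>}"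
  have A: "finite A" "i \<in> A"
    using r Suc.prems(2) by (auto simp: A_def)
  define k where "k = Max A"
  have kA: "k \<in> A" unfolding k_def using A Max_in by blast
  \<comment> \<open>\<open>z k\<close> is the last point of the chain in the ball that contains \<open>z i\<close>\<close>
  have ik: "dist (z i) (z k) \<le> 2 * \<delta>"
    using dist_triangle_le[of "z i" r "z k" "2 * \<delta>"] r(2) kA by (simp add: A_def dist_commute)
  show ?case
  proof (cases "k = j")
    case True
    have "2 * \<delta> \<le> 3 * \<delta> * 1" using Suc.prems(3) by simp
    also have "\<dots> \<le> 3 * \<delta> * real (card R)"
      using Suc.hyps(2) Suc.prems(3) by (intro mult_left_mono) linarith+
    finally show ?thesis using ik True by simp
  next
    case False
    then have kj: "i \<le> k" "k < j" using kA by (auto simp: A_def)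
    have cR: "n = card (R - {r})" using r(1) Suc.hyps(2) Suc.prems(1) by simp
    have "dist (z (Suc k)) (z j) \<le> 3 * \<delta> * card (R - {r})"
    proof (rule Suc.hyps(1)[OF cR])
      fix l assume l: "Suc k \<le> l" "l \<le> j"
      then have "l \<notin> A" using A(1) Max_ge[of A l] unfolding k_def by linarith
      then have "\<not> dist (z l) r \<le> \<delta>" using l kj by (auto simp: A_def)
      moreover obtain r' where "r' \<in> R" "dist (z l) r' \<le> \<delta>"
        using Suc.prems(4)[of l] l kj by auto
      ultimately show "\<exists>r\<in>R - {r}. dist (z l) r \<le> \<delta>" by blast
    qed (use Suc.prems kj in auto)
    moreover have "dist (z k) (z (Suc k)) \<le> \<delta>" using Suc.prems(5) kj by simp
    moreover have "dist (z i) (z j) \<le> dist (z i) (z k) + dist (z k) (z (Suc k)) + dist (z (Suc k)) (z j)"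
      by (metis add_left_mono add.assoc dist_triangle order_trans)
    ultimately have "dist (z i) (z j) \<le> 3 * \<delta> * real n + 3 * \<delta>" using ik cR by simp
    also have "\<dots> = 3 * \<delta> * real (card R)"
      by (simp flip: Suc.hyps(2) add: algebra_simps)
    finally show ?thesis .
  qed
qed

text \<open>
  Quantitative openness: factor \<open>p - v\<close> into linear factors; the root nearest to \<open>z\<close> bounds each
  factor from below.
\<close>

lemma poly_preimage_near:
  fixes p :: "complex poly"
  assumes "degree p > 0"
  obtains r where "poly p r = v"
    and "cmod (lead_coeff p) * dist z r ^ degree p \<le> dist (poly p z) v"
proof -
  define q where "q = p - [:v:]"
  have deg: "degree q = degree p"
    using degree_add_eq_left[of "- [:v:]" p] assms unfolding q_def diff_conv_add_uminus by simp
  have lead: "coeff q (degree p) = lead_coeff p"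
    using assms by (simp add: q_def coeff_pCons split: nat.split)
  obtain root where root: "smult (lead_coeff q) (\<Prod>i<degree q. [:-root i, 1:]) = q"
    by (rule complex_poly_decompose')
  have val: "poly p x - v = lead_coeff p * (\<Prod>i<degree p. x - root i)" for x
  proof -
    have "poly p x - v = poly q x" by (simp add: q_def)
    also have "\<dots> = lead_coeff q * (\<Prod>i<degree q. x - root i)"
      by (subst root[symmetric]) (simp add: poly_prod algebra_simps)
    finally show ?thesis by (simp add: lead deg)
  qed
  define i where "i = arg_min_on (\<lambda>i. dist z (root i)) {..<degree p}"
  have i: "i < degree p" "\<And>j. j < degree p \<Longrightarrow> dist z (root i) \<le> dist z (root j)"
    using arg_min_if_finite[of "{..<degree p}" "\<lambda>i. dist z (root i)"] assms
      arg_min_least[of "{..<degree p}" _ "\<lambda>i. dist z (root i)"]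
    by (auto simp: i_def)
  show thesis
  proof
    have "(\<Prod>j<degree p. root i - root j) = 0" using i(1) by (intro prod_zero) auto
    then have "poly p (root i) - v = 0" using val[of "root i"] by (simp only: mult_zero_right)
    then show "poly p (root i) = v" by simp
    have "dist z (root i) ^ degree p = (\<Prod>j<degree p. dist z (root i))" by simp
    also have "\<dots> \<le> (\<Prod>j<degree p. dist z (root j))" using i(2) by (intro prod_mono) auto
    finally have "dist z (root i) ^ degree p \<le> (\<Prod>j<degree p. dist z (root j))" .
    then have "cmod (lead_coeff p) * dist z (root i) ^ degree p
        \<le> cmod (lead_coeff p) * (\<Prod>j<degree p. dist z (root j))"
      by (intro mult_left_mono) auto
    also have "\<dots> = dist (poly p z) v"
      by (simp add: dist_norm val norm_mult prod_norm)
    finally show "cmod (lead_coeff p) * dist z (root i) ^ degree p \<le> dist (poly p z) v" .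
  qed
qed

text \<open>
  Follow roots greedily, always passing to a nearest preimage of the next value.  As long as the
  values stay within \<open>|lead_coeff p| * \<delta> ^ degree p\<close> of each other, the preimages stay in the
  \<open>\<delta>\<close>-balls around the at most \<open>degree p\<close> preimages of a single value, so the chain lemma bounds
  how far they move.  The bound does not depend on the number of steps; this is the
  equicontinuity that survives the passage to a continuous parameter.
\<close>

lemma poly_lift_sequence:
  fixes p :: "complex poly" and w :: "nat \<Rightarrow> complex"
  assumes "degree p > 0" and "poly p z0 = w 0"
  obtains z where "z 0 = z0" and "\<And>k. poly p (z k) = w k"
    and "\<And>i j \<delta>. i \<le> j \<Longrightarrow> \<delta> \<ge> 0 \<Longrightarrow>
       (\<And>k l. k \<in> {i..j} \<Longrightarrow> l \<in> {i..j} \<Longrightarrow>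
          dist (w k) (w l) \<le> cmod (lead_coeff p) * \<delta> ^ degree p) \<Longrightarrow>
       dist (z i) (z j) \<le> 3 * \<delta> * degree p"
proof -
  have p0: "p \<noteq> 0" using assms(1) by auto
  have lc: "cmod (lead_coeff p) > 0" using p0 by simp
  have "\<exists>z. \<forall>k. (poly p (z k) = w k \<and> (k = 0 \<longrightarrow> z k = z0)) \<and>
      cmod (lead_coeff p) * dist (z k) (z (Suc k)) ^ degree p \<le> dist (w k) (w (Suc k))"
  proof (rule dependent_nat_choice)
    show "\<exists>x. poly p x = w 0 \<and> (0 = (0::nat) \<longrightarrow> x = z0)" using assms(2) by auto
    fix x k assume x: "poly p x = w k \<and> (k = 0 \<longrightarrow> x = z0)"
    obtain r where "poly p r = w (Suc k)"
      "cmod (lead_coeff p) * dist x r ^ degree p \<le> dist (poly p x) (w (Suc k))"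
      by (rule poly_preimage_near[OF assms(1)])
    then show "\<exists>y. (poly p y = w (Suc k) \<and> (Suc k = 0 \<longrightarrow> y = z0)) \<and>
      cmod (lead_coeff p) * dist x y ^ degree p \<le> dist (w k) (w (Suc k))" using x by auto
  qed
  then obtain z where z: "\<And>k. poly p (z k) = w k" "z 0 = z0"
      "\<And>k. cmod (lead_coeff p) * dist (z k) (z (Suc k)) ^ degree p \<le> dist (w k) (w (Suc k))"
    by blast
  have near: "d \<le> \<delta>" if "cmod (lead_coeff p) * d ^ degree p \<le> cmod (lead_coeff p) * \<delta> ^ degree p"
    "\<delta> \<ge> 0" for d \<delta>
  proof (rule ccontr)
    assume "\<not> d \<le> \<delta>"
    then have "\<delta> ^ degree p < d ^ degree p" using that(2) assms(1) by (intro power_strict_mono) auto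
    then show False using that(1) lc by simp
  qed
  show thesis
  proof (rule that[OF z(2) z(1)])
    fix i j :: nat and \<delta> :: real
    assume ij: "i \<le> j" "\<delta> \<ge> 0" and w: "\<And>k l. k \<in> {i..j} \<Longrightarrow> l \<in> {i..j} \<Longrightarrow>
          dist (w k) (w l) \<le> cmod (lead_coeff p) * \<delta> ^ degree p"
    define q where "q = p - [:w i:]"
    have q: "q \<noteq> 0" "degree q \<le> degree p"
      using assms(1) by (auto simp: q_def intro: degree_diff_le)
    define R where "R = {r. poly q r = 0}"
    have "dist (z i) (z j) \<le> 3 * \<delta> * card R"
    proof (rule dist_le_chain_in_balls[OF _ ij])
      show "finite R" unfolding R_def using q(1) by (rule poly_roots_finite)
      show "\<exists>r\<in>R. dist (z k) r \<le> \<delta>" if k: "i \<le> k" "k \<le> j" for k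
      proof -
        obtain r where r: "poly p r = w i"
          "cmod (lead_coeff p) * dist (z k) r ^ degree p \<le> dist (poly p (z k)) (w i)"
          by (rule poly_preimage_near[OF assms(1)])
        have "dist (w k) (w i) \<le> cmod (lead_coeff p) * \<delta> ^ degree p" using k by (intro w) auto
        with r(2) have "cmod (lead_coeff p) * dist (z k) r ^ degree p
            \<le> cmod (lead_coeff p) * \<delta> ^ degree p"
          unfolding z(1) by (rule order_trans)
        then have "dist (z k) r \<le> \<delta>" by (rule near[OF _ ij(2)])
        then show ?thesis using r(1) by (auto simp: R_def q_def)
      qed
      show "dist (z k) (z (Suc k)) \<le> \<delta>" if "i \<le> k" "k < j" for k
      proof (rule near[OF order_trans[OF z(3)] ij(2)])
        show "dist (w k) (w (Suc k)) \<le> cmod (lead_coeff p) * \<delta> ^ degree p"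
          using that by (intro w) auto
      qed
    qed
    also have "\<dots> \<le> 3 * \<delta> * degree p"
      using card_poly_roots_bound[OF q(1)] q(2) ij(2) by (intro mult_left_mono) (auto simp: R_def)
    finally show "dist (z i) (z j) \<le> 3 * \<delta> * degree p" .
  qed
qed

text \<open>
  The same for finitely many real times.  The oscillation of \<open>w\<close> is measured on a whole interval,
  so that the bound between two given times does not refer to the set \<open>F\<close>.
\<close>

lemma poly_lift_finite:
  fixes p :: "complex poly" and w :: "real \<Rightarrow> complex"
  assumes "degree p > 0" and "finite F" and F: "0 \<in> F" "F \<subseteq> {0..}" and z0: "poly p z0 = w 0"
  obtains z where "z 0 = z0" and "\<And>t. t \<in> F \<Longrightarrow> poly p (z t) = w t"
    and "\<And>s t \<delta>. s \<in> F \<Longrightarrow> t \<in> F \<Longrightarrow> s \<le> t \<Longrightarrow> \<delta> \<ge> 0 \<Longrightarrow>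
       (\<And>u v. u \<in> {s..t} \<Longrightarrow> v \<in> {s..t} \<Longrightarrow>
          dist (w u) (w v) \<le> cmod (lead_coeff p) * \<delta> ^ degree p) \<Longrightarrow>
       dist (z s) (z t) \<le> 3 * \<delta> * degree p"
proof -
  define l where "l = sorted_list_of_set F"
  have l: "sorted l" "distinct l" "set l = F" using assms(2) by (auto simp: l_def)
  define N where "N = length l"
  have N: "N > 0" using l(3) F(1) by (auto simp: N_def)
  have inj: "inj_on ((!) l) {..<N}" using l(2) by (simp add: N_def inj_on_nth)
  have lF: "l ! k \<in> F" if "k < N" for k using that l(3) nth_mem N_def by blast
  define ix where "ix = inv_into {..<N} ((!) l)"
  have img: "(!) l ` {..<N} = F" using l(3) by (auto simp: N_def set_conv_nth)
  have ix: "ix t < N" "l ! ix t = t" if "t \<in> F" for t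
    using that img inv_into_into[of t "(!) l" "{..<N}"] f_inv_into_f[of t "(!) l" "{..<N}"]
    by (auto simp: ix_def)
  have mono: "l ! i \<le> l ! j" if "i \<le> j" "j < N" for i j
    using that l(1) by (simp add: N_def sorted_nth_mono)
  have l0: "l ! 0 = 0"
    using mono[of 0 "ix 0"] ix[OF F(1)] lF[OF N] F(2) by force
  have ix0: "ix 0 = 0" using inv_into_f_f[OF inj, of 0] N l0 by (simp add: ix_def)
  obtain y where y: "y 0 = z0" "\<And>k. poly p (y k) = w (l ! k)"
    and yd: "\<And>i j \<delta>. i \<le> j \<Longrightarrow> \<delta> \<ge> 0 \<Longrightarrow>
       (\<And>k m. k \<in> {i..j} \<Longrightarrow> m \<in> {i..j} \<Longrightarrow>
          dist (w (l ! k)) (w (l ! m)) \<le> cmod (lead_coeff p) * \<delta> ^ degree p) \<Longrightarrow>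
       dist (y i) (y j) \<le> 3 * \<delta> * degree p"
    using poly_lift_sequence[OF assms(1), of z0 "\<lambda>k. w (l ! k)"] z0 l0 by auto
  show thesis
  proof (rule that[of "\<lambda>t. y (ix t)"])
    show "y (ix 0) = z0" by (simp add: ix0 y)
    show "poly p (y (ix t)) = w t" if "t \<in> F" for t using y(2) ix[OF that] by simp
    fix s t \<delta> assume st: "s \<in> F" "t \<in> F" "s \<le> t" "\<delta> \<ge> (0::real)"
      and w: "\<And>u v. u \<in> {s..t} \<Longrightarrow> v \<in> {s..t} \<Longrightarrow>
          dist (w u) (w v) \<le> cmod (lead_coeff p) * \<delta> ^ degree p"
    have "ix s \<le> ix t"
      using mono[of "ix t" "ix s"] ix[OF st(1)] ix[OF st(2)] st(3) by (cases "ix s \<le> ix t") auto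
    moreover have "l ! k \<in> {s..t}" if "k \<in> {ix s..ix t}" for k
      using that mono[of "ix s" k] mono[of k "ix t"] ix[OF st(1)] ix[OF st(2)] by auto
    ultimately show "dist (y (ix s)) (y (ix t)) \<le> 3 * \<delta> * degree p"
      using w st(4) by (intro yd) auto
  qed
qed

text \<open>
  The lifts on finite sets of times are glued by compactness.  The candidates form the product of
  the finite fibres \<open>K t\<close> of \<open>p\<close> over the values \<open>w t\<close>, compact by Tychonoff's theorem.  Every
  constraint on how far the lift may move between two times is closed, and finitely many of them can
  be met by the lift on a finite set.  A function that meets them all inherits uniform continuity
  from \<open>w\<close>.  Since no local inverses are used, critical points of \<open>p\<close> need no special treatment.
\<close>

proposition poly_lift_path:
  fixes p :: "complex poly"
  assumes deg: "degree p > 0" and w: "path w" and z0: "poly p z0 = w 0"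
  obtains z where "path z" "z 0 = z0" "\<And>t. t \<in> {0..1} \<Longrightarrow> poly p (z t) = w t"
proof -
  define c where "c = cmod (lead_coeff p)"
  have c: "c > 0" unfolding c_def using deg by auto
  define m where "m = degree p"
  \<comment> \<open>at \<open>0\<close> only the prescribed start is allowed; off the unit interval any finite nonempty set would do\<close>
  define K where "K t = (if t \<in> {0<..1} then {x. poly p x = w t} else {z0})" for t
  have finK: "finite (K t)" for t
  proof -
    have "p - [:w t:] \<noteq> 0" using deg by auto
    then have "finite {x. poly (p - [:w t:]) x = 0}" by (rule poly_roots_finite)
    then show ?thesis by (simp add: K_def)
  qed
  define I where "I = {(s, t, \<delta>). 0 \<le> s \<and> s \<le> t \<and> t \<le> 1 \<and> \<delta> \<ge> 0 \<and>
      (\<forall>u\<in>{s..t}. \<forall>v\<in>{s..t}. dist (w u) (w v) \<le> c * \<delta> ^ m)}"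
  define T where "T = (\<lambda>(s, t, \<delta> :: real). {z :: real \<Rightarrow> complex. dist (z s) (z t) \<le> 3 * \<delta> * m})"
  have "Pi\<^sub>E UNIV K \<inter> (\<Inter>i\<in>I. T i) \<noteq> {}"
  proof (rule compact_imp_fip_image)
    have "compactin (product_topology (\<lambda>i. euclidean) UNIV) (Pi\<^sub>E UNIV K)"
      unfolding compactin_PiE using finK by (auto intro: finite_imp_compact)
    then show "compact (Pi\<^sub>E UNIV K)" by (simp add: euclidean_product_topology)
    show "closed (T i)" for i
    proof -
      obtain s t \<delta> where i: "i = (s, t, \<delta>)" by (cases i)
      show ?thesis
        unfolding T_def i prod.case
        by (intro closed_Collect_le continuous_on_dist continuous_on_product_coordinates
            continuous_on_const)
    qed
  next
    fix I' assume I': "finite I'" "I' \<subseteq> I"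
    define F where "F = insert 0 (fst ` I' \<union> (fst \<circ> snd) ` I')"
    have F: "finite F" "0 \<in> F" "F \<subseteq> {0..1}"
    proof -
      show "finite F" using I'(1) by (simp add: F_def)
      show "0 \<in> F" by (simp add: F_def)
      have "fst i \<in> {0..1} \<and> fst (snd i) \<in> {0..1}" if "i \<in> I'" for i
      proof -
        have "i \<in> I" using that I'(2) by (rule rev_subsetD)
        then show ?thesis by (auto simp: I_def)
      qed
      then show "F \<subseteq> {0..1}" by (simp add: F_def image_subset_iff)
    qed
    have Fpos: "F \<subseteq> {0..}" using F(3) by auto
    obtain z where z: "z 0 = z0" "\<And>t. t \<in> F \<Longrightarrow> poly p (z t) = w t"
      and zd: "\<And>s t \<delta>. s \<in> F \<Longrightarrow> t \<in> F \<Longrightarrow> s \<le> t \<Longrightarrow> \<delta> \<ge> 0 \<Longrightarrow>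
       (\<And>u v. u \<in> {s..t} \<Longrightarrow> v \<in> {s..t} \<Longrightarrow> dist (w u) (w v) \<le> c * \<delta> ^ m) \<Longrightarrow>
       dist (z s) (z t) \<le> 3 * \<delta> * m"
      unfolding c_def m_def
      using poly_lift_finite[where w = w and F = F, OF deg F(1,2) Fpos z0] that by metis
    have ne: "K t \<noteq> {}" for t
    proof -
      obtain r where "poly p r = w t"
        using poly_preimage_near[OF deg, where v = "w t" and z = 0] by blast
      then have "(if t \<in> {0<..1} then r else z0) \<in> K t" by (simp add: K_def)
      then show ?thesis by (metis empty_iff)
    qed
    define Z where "Z t = (if t \<in> F then z t else SOME x. x \<in> K t)" for t
    have "Z t \<in> K t" for t
    proof (cases "t \<in> F")
      case True
      then show ?thesis using z F(3) by (cases "t = 0") (force simp: Z_def K_def)+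
    next
      case False
      then show ?thesis using ne by (simp add: Z_def some_in_eq)
    qed
    moreover have "Z \<in> T i" if "i \<in> I'" for i
    proof -
      obtain s t \<delta> where i: "i = (s, t, \<delta>)" by (cases i)
      have st: "s \<in> F" "t \<in> F" using that i by (force simp: F_def)+
      have "dist (z s) (z t) \<le> 3 * \<delta> * m"
        using that i I'(2) by (intro zd st) (auto simp: I_def)
      then show ?thesis using st i by (simp add: T_def Z_def)
    qed
    ultimately have "Z \<in> Pi\<^sub>E UNIV K \<inter> (\<Inter>i\<in>I'. T i)" by (simp add: PiE_UNIV_domain)
    then show "Pi\<^sub>E UNIV K \<inter> (\<Inter>i\<in>I'. T i) \<noteq> {}" by (blast dest: equals0D)
  qed
  then obtain z where "z \<in> Pi\<^sub>E UNIV K \<inter> (\<Inter>i\<in>I. T i)" unfolding ex_in_conv[symmetric] by (rule exE)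
  then have zK: "z t \<in> K t" and zT: "i \<in> I \<Longrightarrow> z \<in> T i" for t i by (simp_all add: PiE_UNIV_domain Pi_iff)
  have "uniformly_continuous_on {0..1} w"
    using w by (simp add: path_def compact_uniformly_continuous)
  have "uniformly_continuous_on {0..1} z"
    unfolding uniformly_continuous_on_def
  proof (intro allI impI)
    fix e :: real assume e: "e > 0"
    define \<delta> where "\<delta> = e / (3 * m + 1)"
    have \<delta>: "\<delta> > 0" using e by (simp add: \<delta>_def)
    have \<delta>m: "3 * \<delta> * m < e" using e by (simp add: \<delta>_def field_simps)
    have "c * \<delta> ^ m > 0" using c \<delta> by simp
    then obtain d where d: "d > 0"
      "\<And>u v. u \<in> {0..1} \<Longrightarrow> v \<in> {0..1} \<Longrightarrow> dist v u < d \<Longrightarrow> dist (w v) (w u) < c * \<delta> ^ m"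
      using \<open>uniformly_continuous_on {0..1} w\<close> unfolding uniformly_continuous_on_def by meson
    have less: "dist (z s) (z t) < e" if "s \<in> {0..1}" "t \<in> {0..1}" "s \<le> t" "dist s t < d" for s t
    proof -
      have "(s, t, \<delta>) \<in> I"
      proof -
        have "dist (w u) (w v) \<le> c * \<delta> ^ m" if "u \<in> {s..t}" "v \<in> {s..t}" for u v
        proof (rule less_imp_le[OF d(2)])
          show "dist u v < d" using that \<open>dist s t < d\<close> by (auto simp: dist_real_def)
        qed (use that \<open>s \<in> {0..1}\<close> \<open>t \<in> {0..1}\<close> in auto)
        then show ?thesis unfolding I_def using that \<delta> by simp
      qed
      from zT[OF this] show ?thesis using \<delta>m by (simp add: T_def)
    qed
    show "\<exists>d>0. \<forall>x\<in>{0..1}. \<forall>x'\<in>{0..1}. dist x' x < d \<longrightarrow> dist (z x') (z x) < e"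
    proof (intro exI[of _ d] conjI d(1) ballI impI)
      fix s t :: real assume "s \<in> {0..1}" "t \<in> {0..1}" "dist t s < d"
      then show "dist (z t) (z s) < e"
        using less[of s t] less[of t s] by (cases "s \<le> t") (simp_all add: dist_commute)
    qed
  qed
  then have "path z" by (simp add: path_def uniformly_continuous_imp_continuous)
  moreover have "z 0 = z0" using zK[of 0] by (simp add: K_def)
  moreover have "poly p (z t) = w t" if "t \<in> {0..1}" for t
    using zK[of t] zK[of 0] that z0 by (cases "t = 0") (auto simp: K_def)
  ultimately show thesis by (rule that)
qed

section \<open>Crofton's bound for the length of a curve\<close>

text \<open>
  One half of Banach's indicatrix theorem: the variation of \<open>g\<close> is at most the integral of the
  number of solutions of \<open>g t = y\<close> over \<open>y\<close>.  Each increment is the measure of the values between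
  its end points, and by the intermediate value theorem a value that lies strictly between the end
  points of several increments is attained once inside each of the corresponding intervals.
\<close>

lemma sum_abs_increments_le:
  fixes g :: "real \<Rightarrow> real"
  assumes g: "continuous_on {0..1} g" "\<And>t. t \<in> {0..1} \<Longrightarrow> g t \<in> {a..b}"
    and B: "finite B"
    and level: "\<And>y. y \<notin> B \<Longrightarrow> finite {t\<in>{0..1}. g t = y} \<and> card {t\<in>{0..1}. g t = y} \<le> n"
    and t: "mono_on {..N} t" "t ` {..N} \<subseteq> {0..1}"
  shows "(\<Sum>i<N. \<bar>g (t (Suc i)) - g (t i)\<bar>) \<le> n * (b - a)"
proof -
  have t01: "t i \<in> {0..1}" if "i \<le> N" for i using t(2) that by blast
  have tmono: "t i \<le> t j" if "i \<le> j" "j \<le> N" for i j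
    using that by (intro mono_onD[OF t(1)]) auto
  have ab: "a \<le> b" using g(2)[of 0] by simp
  define lo hi where "lo i = min (g (t i)) (g (t (Suc i)))"
    and "hi i = max (g (t i)) (g (t (Suc i)))" for i
  \<comment> \<open>values attained at a subdivision point are discarded, so that no solution is counted twice\<close>
  define P where "P = B \<union> (g \<circ> t) ` {..N}"
  have P: "finite P" using B by (simp add: P_def)
  have ind: "(indicator {lo i..hi i} has_integral \<bar>g (t (Suc i)) - g (t i)\<bar>) {a..b}" if "i < N" for i
  proof -
    have "((\<lambda>_. 1::real) has_integral \<bar>g (t (Suc i)) - g (t i)\<bar>) {lo i..hi i}"
    proof -
      have "hi i - lo i = \<bar>g (t (Suc i)) - g (t i)\<bar>" "lo i \<le> hi i"
        by (auto simp: lo_def hi_def)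
      then show ?thesis using has_integral_const_real[of "1::real" "lo i" "hi i"] by simp
    qed
    moreover have "{lo i..hi i} \<subseteq> {a..b}"
      using g(2)[OF t01[of i]] g(2)[OF t01[of "Suc i"]] that by (auto simp: lo_def hi_def)
    ultimately show ?thesis
      using has_integral_restrict[of "{lo i..hi i}" "{a..b}" "\<lambda>_. 1 :: real"]
      unfolding indicator_def[abs_def] of_bool_def by blast
  qed
  have "((\<lambda>y. \<Sum>i<N. indicator {lo i..hi i} y) has_integral
      (\<Sum>i<N. \<bar>g (t (Suc i)) - g (t i)\<bar>)) {a..b}"
    by (intro has_integral_sum) (auto intro: ind)
  then have spike: "((\<lambda>y. if y \<in> P then 0 else \<Sum>i<N. indicator {lo i..hi i} y) has_integral
      (\<Sum>i<N. \<bar>g (t (Suc i)) - g (t i)\<bar>)) {a..b}"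
    by (rule has_integral_spike_finite[OF P, rotated]) auto
  have count: "(\<Sum>i<N. indicator {lo i..hi i} y) \<le> real n" if y: "y \<notin> P" for y
  proof -
    define J where "J = {i. i < N \<and> lo i \<le> y \<and> y \<le> hi i}"
    have "(\<Sum>i<N. indicator {lo i..hi i} y) = real (card J)"
      by (simp add: indicator_def J_def sum.If_cases Int_def)
    also have "card J \<le> card {s\<in>{0..1}. g s = y}"
    proof -
      have "\<exists>s. t i < s \<and> s < t (Suc i) \<and> g s = y" if "i \<in> J" for i
      proof -
        have i: "i < N" "lo i \<le> y" "y \<le> hi i" using that by (auto simp: J_def)
        have le: "t i \<le> t (Suc i)" using tmono i(1) by simp
        have sub: "{t i..t (Suc i)} \<subseteq> {0..1}" using t01[of i] t01[of "Suc i"] i(1) by auto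
        have cont: "continuous_on {t i..t (Suc i)} g" using g(1) sub by (rule continuous_on_subset)
        have ne: "g (t i) \<noteq> y" "g (t (Suc i)) \<noteq> y" using y i(1) by (auto simp: P_def)
        have "\<exists>s. t i \<le> s \<and> s \<le> t (Suc i) \<and> g s = y"
        proof (cases "g (t i) \<le> g (t (Suc i))")
          case True
          then show ?thesis using IVT'[of g "t i" y "t (Suc i)"] i le cont by (auto simp: lo_def hi_def)
        next
          case False
          then show ?thesis using IVT2'[of g "t (Suc i)" y "t i"] i le cont by (auto simp: lo_def hi_def)
        qed
        then show ?thesis using ne by (metis less_eq_real_def)
      qed
      then obtain s where s: "\<And>i. i \<in> J \<Longrightarrow> t i < s i \<and> s i < t (Suc i) \<and> g (s i) = y" by metis
      have lt: "s i < s j" if "i \<in> J" "j \<in> J" "i < j" for i j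
        using s[OF that(1)] s[OF that(2)] tmono[of "Suc i" j] that by (auto simp: J_def)
      have "inj_on s J"
        by (rule inj_onI) (metis lt less_irrefl linorder_neqE_nat)
      moreover have "s ` J \<subseteq> {s\<in>{0..1}. g s = y}"
      proof clarify
        fix i assume i: "i \<in> J"
        then have "0 \<le> t i" "t (Suc i) \<le> 1" using t01[of i] t01[of "Suc i"] by (auto simp: J_def)
        then show "s i \<in> {0..1} \<and> g (s i) = y" using s[OF i] by simp
      qed
      moreover have "finite {s\<in>{0..1}. g s = y}" using level[of y] y by (simp add: P_def)
      ultimately show ?thesis by (metis card_inj_on_le)
    qed
    also have "\<dots> \<le> n" using level[of y] y by (simp add: P_def)
    finally show ?thesis by simp
  qed
  have "((\<lambda>_. real n) has_integral real n * (b - a)) {a..b}"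
    using ab has_integral_const_real[of "real n" a b] by (simp add: mult.commute)
  with spike show ?thesis
    by (rule has_integral_le) (use count in auto)
qed

lemma has_integral_abs_cos_shift:
  assumes "\<alpha> \<in> {-pi/2..pi/2}"
  shows "((\<lambda>\<theta>. \<bar>cos (\<theta> - \<alpha>)\<bar>) has_integral 2) {0..pi}"
proof -
  \<comment> \<open>the point where \<open>cos (\<theta> - \<alpha>)\<close> changes sign\<close>
  define c where "c = \<alpha> + pi/2"
  have c: "0 \<le> c" "c \<le> pi" using assms by (auto simp: c_def)
  have "((\<lambda>\<theta>. cos (\<theta> - \<alpha>)) has_integral sin (c - \<alpha>) - sin (0 - \<alpha>)) {0..c}"
    using c by (intro fundamental_theorem_of_calculus)
      (auto intro!: derivative_eq_intros simp flip: has_real_derivative_iff_has_vector_derivative)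
  moreover have "cos (\<theta> - \<alpha>) = \<bar>cos (\<theta> - \<alpha>)\<bar>" if "\<theta> \<in> {0..c}" for \<theta>
    using that assms cos_ge_zero[of "\<theta> - \<alpha>"] by (auto simp: c_def)
  ultimately have 1: "((\<lambda>\<theta>. \<bar>cos (\<theta> - \<alpha>)\<bar>) has_integral sin (c - \<alpha>) - sin (0 - \<alpha>)) {0..c}"
    by (rule has_integral_eq[rotated])
  have "((\<lambda>\<theta>. - cos (\<theta> - \<alpha>)) has_integral (- sin (pi - \<alpha>)) - (- sin (c - \<alpha>))) {c..pi}"
    using c by (intro fundamental_theorem_of_calculus)
      (auto intro!: derivative_eq_intros simp flip: has_real_derivative_iff_has_vector_derivative)
  moreover have "- cos (\<theta> - \<alpha>) = \<bar>cos (\<theta> - \<alpha>)\<bar>" if "\<theta> \<in> {c..pi}" for \<theta>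
    using that assms cos_ge_zero[of "\<theta> - \<alpha> - pi"] by (auto simp: c_def cos_diff)
  ultimately have 2: "((\<lambda>\<theta>. \<bar>cos (\<theta> - \<alpha>)\<bar>) has_integral (- sin (pi - \<alpha>)) - (- sin (c - \<alpha>))) {c..pi}"
    by (rule has_integral_eq[rotated])
  have "sin (c - \<alpha>) - sin (0 - \<alpha>) + ((- sin (pi - \<alpha>)) - (- sin (c - \<alpha>))) = 2"
    by (simp add: c_def)
  then show ?thesis using has_integral_combine[OF c 1 2] by simp
qed

text \<open>
  Averaging over all directions recovers the length of a segment from its projections.  Replacing
  \<open>z\<close> by \<open>- z\<close> if necessary, \<open>Arg z\<close> lies in \<open>{-pi/2..pi/2}\<close>, where the cosine integral applies.
\<close>

lemma has_integral_abs_projection: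
  "((\<lambda>\<theta>. \<bar>Re (cnj (cis \<theta>) * z)\<bar>) has_integral 2 * cmod z) {0..pi}"
proof -
  have *: "((\<lambda>\<theta>. \<bar>Re (cnj (cis \<theta>) * z)\<bar>) has_integral 2 * cmod z) {0..pi}" if "Re z \<ge> 0" for z
  proof (cases "z = 0")
    case False
    define \<alpha> where "\<alpha> = Arg z"
    have z: "z = rcis (cmod z) \<alpha>" by (simp add: \<alpha>_def rcis_cmod_Arg)
    have "\<alpha> \<in> {-pi/2..pi/2}" using that False Re_Ln_pos_le[of z] Arg_eq_Im_Ln[of z]
      by (auto simp: \<alpha>_def abs_le_iff)
    then have "((\<lambda>\<theta>. \<bar>cos (\<theta> - \<alpha>)\<bar> * cmod z) has_integral 2 * cmod z) {0..pi}"
      by (intro has_integral_mult_left has_integral_abs_cos_shift)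
    moreover have "\<bar>Re (cnj (cis \<theta>) * z)\<bar> = \<bar>cos (\<theta> - \<alpha>)\<bar> * cmod z" for \<theta>
    proof -
      have "Re (cnj (cis \<theta>) * z) = Re (cnj (cis \<theta>) * rcis (cmod z) \<alpha>)" using z by simp
      also have "\<dots> = cos (\<theta> - \<alpha>) * cmod z" by (simp add: cos_diff algebra_simps)
      finally show ?thesis by (simp add: abs_mult)
    qed
    ultimately show ?thesis by simp
  qed auto
  show ?thesis
  proof (cases "Re z \<ge> 0")
    case False
    then have "((\<lambda>\<theta>. \<bar>Re (cnj (cis \<theta>) * - z)\<bar>) has_integral 2 * cmod (- z)) {0..pi}"
      by (intro *) simp
    moreover have "\<bar>Re (cnj (cis \<theta>) * - z)\<bar> = \<bar>Re (cnj (cis \<theta>) * z)\<bar>" for \<theta>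
      by (simp only: mult_minus_right uminus_complex.sel abs_minus_cancel)
    ultimately show ?thesis by (simp only: norm_minus_cancel)
  qed (rule *)
qed

text \<open>
  Crofton's argument for an inscribed polygon: average the projections of its sides over all
  directions.  In each direction the projected vertices are values of the projection of \<open>\<gamma>\<close>, a function
  with values in \<open>{-1..1}\<close> that takes all but finitely many values at most \<open>n\<close> times, so the
  projected sides have total length at most \<open>2 * n\<close>.  Integrating over \<open>{0..pi}\<close> gives \<open>2 * pi * n\<close>,
  which is twice the bound for the polygon.
\<close>

proposition curve_length_le_Crofton:
  fixes \<gamma> :: "real \<Rightarrow> complex"
  assumes \<gamma>: "path \<gamma>" "path_image \<gamma> \<subseteq> cball 0 1"
    and level: "\<And>\<theta>. \<exists>B. finite B \<and> (\<forall>y. y \<notin> B \<longrightarrow>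
        finite {t\<in>{0..1}. Re (cnj (cis \<theta>) * \<gamma> t) = y} \<and>
        card {t\<in>{0..1}. Re (cnj (cis \<theta>) * \<gamma> t) = y} \<le> n)"
  shows "curve_length \<gamma> \<le> ennreal (pi * n)"
  unfolding curve_length_def
proof (rule Sup_least, clarify)
  fix N and t :: "nat \<Rightarrow> real"
  assume t: "mono_on {..N} t" "t ` {..N} \<subseteq> {0..1}"
  define d where "d i = \<gamma> (t (Suc i)) - \<gamma> (t i)" for i
  have sum: "((\<lambda>\<theta>. \<Sum>i<N. \<bar>Re (cnj (cis \<theta>) * d i)\<bar>) has_integral (\<Sum>i<N. 2 * cmod (d i))) {0..pi}"
    by (intro has_integral_sum has_integral_abs_projection) auto
  have const: "((\<lambda>_. 2 * real n) has_integral pi * (2 * n)) {0..pi}"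
    using has_integral_const_real[of "2 * real n" 0 pi] by simp
  have "(\<Sum>i<N. \<bar>Re (cnj (cis \<theta>) * d i)\<bar>) \<le> 2 * real n" for \<theta>
  proof -
    define g where "g s = Re (cnj (cis \<theta>) * \<gamma> s)" for s
    obtain B where B: "finite B" "\<And>y. y \<notin> B \<Longrightarrow>
        finite {t\<in>{0..1}. g t = y} \<and> card {t\<in>{0..1}. g t = y} \<le> n"
      using level[of \<theta>] unfolding g_def by blast
    have "continuous_on {0..1} g"
      unfolding g_def using \<gamma>(1) by (auto simp: path_def intro!: continuous_intros)
    moreover have "g s \<in> {-1..1}" if "s \<in> {0..1}" for s
    proof -
      have "\<bar>g s\<bar> \<le> cmod (cnj (cis \<theta>) * \<gamma> s)" unfolding g_def by (rule abs_Re_le_cmod)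
      also have "\<dots> = cmod (\<gamma> s)" by (simp add: norm_mult)
      also have "\<dots> \<le> 1" using \<gamma>(2) that by (force simp: path_image_def)
      finally show ?thesis by auto
    qed
    ultimately have "(\<Sum>i<N. \<bar>g (t (Suc i)) - g (t i)\<bar>) \<le> n * (1 - (-1::real))"
      using B t by (rule sum_abs_increments_le)
    then show ?thesis by (simp add: g_def d_def right_diff_distrib)
  qed
  then have "(\<Sum>i<N. 2 * cmod (d i)) \<le> pi * (2 * n)"
    by (intro has_integral_le[OF sum const])
  then have "(\<Sum>i<N. cmod (d i)) \<le> pi * n" by (simp flip: sum_distrib_left)
  then show "ennreal (\<Sum>i<N. dist (\<gamma> (t i)) (\<gamma> (t (Suc i)))) \<le> ennreal (pi * n)"
    by (intro ennreal_leI) (simp add: d_def dist_norm norm_minus_commute)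
qed

lemma curve_length_linepath_le: "curve_length (linepath a b) \<le> ennreal (dist a b)"
  for a b :: "'a::real_normed_vector"
  unfolding curve_length_def
proof (rule Sup_least, clarify)
  fix N and t :: "nat \<Rightarrow> real"
  assume t: "mono_on {..N} t" "t ` {..N} \<subseteq> {0..1}"
  have "dist (linepath a b (t i)) (linepath a b (t (Suc i))) = (t (Suc i) - t i) * dist a b"
    if "i < N" for i
  proof -
    have "linepath a b (t (Suc i)) - linepath a b (t i) = (t (Suc i) - t i) *\<^sub>R (b - a)"
      by (simp add: linepath_def algebra_simps)
    moreover have "t i \<le> t (Suc i)" using that by (intro mono_onD[OF t(1)]) auto
    ultimately show ?thesis by (metis abs_of_nonneg diff_ge_0_iff_ge dist_commute dist_norm norm_scaleR)
  qed
  then have "(\<Sum>i<N. dist (linepath a b (t i)) (linepath a b (t (Suc i))))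
      = (\<Sum>i<N. t (Suc i) - t i) * dist a b"
    by (simp add: sum_distrib_right)
  also have "\<dots> = (t N - t 0) * dist a b" by (simp add: sum_lessThan_telescope)
  also have "\<dots> \<le> 1 * dist a b"
  proof (intro mult_right_mono zero_le_dist)
    have "t N \<in> {0..1}" "t 0 \<in> {0..1}" using t(2) by auto
    then show "t N - t 0 \<le> 1" by simp
  qed
  finally show "ennreal (\<Sum>i<N. dist (linepath a b (t i)) (linepath a b (t (Suc i))))
      \<le> ennreal (dist a b)"
    by (simp add: ennreal_leI)
qed

section \<open>Curves on which a polynomial is real\<close>

lemma poly_map_poly_Im: "poly (map_poly Im p) s = Im (poly p (of_real s))"
  by (induction p) (simp_all add: map_poly_pCons)

text \<open>
  In the coordinates \<open>z = cis \<theta> * Complex y s\<close>, the function \<open>Im (poly q z)\<close> is a real polynomial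
  in \<open>s\<close> for fixed \<open>y\<close> and in \<open>y\<close> for fixed \<open>s\<close>.  If it vanished identically in \<open>s\<close> for infinitely
  many \<open>y\<close>, it would vanish identically in \<open>y\<close> for every \<open>s\<close>; but \<open>q\<close> is nonconstant and takes the
  value \<open>\<i>\<close>.
\<close>

lemma line_meets_real_preimage_finitely:
  fixes q :: "complex poly"
  assumes "degree q > 0"
  obtains B where "finite B"
    and "\<And>y. y \<notin> B \<Longrightarrow> finite {z. Im (poly q z) = 0 \<and> Re (cnj (cis \<theta>) * z) = y}"
    and "\<And>y. y \<notin> B \<Longrightarrow> card {z. Im (poly q z) = 0 \<and> Re (cnj (cis \<theta>) * z) = y} \<le> degree q"
proof -
  define pt where "pt y s = cis \<theta> * Complex y s" for y s
  define u where "u y = map_poly Im (pcompose q [:cis \<theta> * of_real y, cis \<theta> * \<i>:])" for y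
  define v where "v s = map_poly Im (pcompose q [:cis \<theta> * \<i> * of_real s, cis \<theta>:])" for s
  have u: "poly (u y) s = Im (poly q (pt y s))" for y s
    by (simp add: u_def pt_def poly_map_poly_Im poly_pcompose Complex_eq algebra_simps)
  have v: "poly (v s) y = Im (poly q (pt y s))" for y s
    by (simp add: v_def pt_def poly_map_poly_Im poly_pcompose Complex_eq algebra_simps)
  have pt: "z = pt (Re (cnj (cis \<theta>) * z)) (Im (cnj (cis \<theta>) * z))" for z
  proof -
    have "pt (Re (cnj (cis \<theta>) * z)) (Im (cnj (cis \<theta>) * z)) = cis \<theta> * cnj (cis \<theta>) * z"
      by (simp only: pt_def complex_surj mult.assoc)
    also have "cis \<theta> * cnj (cis \<theta>) = 1" by (simp flip: complex_norm_square)
    finally show ?thesis by simp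
  qed
  define B where "B = {y. u y = 0}"
  have deg: "degree (u y) \<le> degree q" for y
  proof -
    have "degree (u y) \<le> degree (pcompose q [:cis \<theta> * of_real y, cis \<theta> * \<i>:])"
      unfolding u_def by (intro degree_le) (simp add: coeff_map_poly coeff_eq_0)
    also have "\<dots> \<le> degree q * degree [:cis \<theta> * of_real y, cis \<theta> * \<i>:]"
      by (rule degree_pcompose_le)
    also have "\<dots> \<le> degree q * 1" by (intro mult_left_mono) (simp_all add: degree_pCons_eq_if)
    finally show ?thesis by simp
  qed
  show thesis
  proof (rule that[of B])
    show "finite B"
    proof (rule ccontr)
      assume inf: "infinite B"
      have "v s = 0" for s
      proof (rule ccontr)
        assume "v s \<noteq> 0"
        then have "finite {y. poly (v s) y = 0}" by (rule poly_roots_finite)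
        moreover have "B \<subseteq> {y. poly (v s) y = 0}" using u v by (auto simp: B_def) (metis poly_0)
        ultimately show False using inf finite_subset by blast
      qed
      then have "Im (poly q z) = 0" for z using v pt[of z] by (metis poly_0)
      moreover obtain r where "poly q r = \<i>"
        using poly_preimage_near[OF assms, where v = \<i> and z = 0] by blast
      ultimately have "Im \<i> = 0" by metis
      then show False by simp
    qed
    fix y assume "y \<notin> B"
    then have "u y \<noteq> 0" by (simp add: B_def)
    let ?Z = "{z. Im (poly q z) = 0 \<and> Re (cnj (cis \<theta>) * z) = y}" and ?R = "{s. poly (u y) s = 0}"
    have sub: "?Z \<subseteq> pt y ` ?R"
    proof
      fix z assume z: "z \<in> ?Z"
      define s where "s = Im (cnj (cis \<theta>) * z)"
      have "z = pt y s" using pt[of z] z by (simp only: s_def mem_Collect_eq)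
      moreover from this have "s \<in> ?R" using z u by simp
      ultimately show "z \<in> pt y ` ?R" by (rule image_eqI)
    qed
    have fin: "finite ?R" using \<open>u y \<noteq> 0\<close> by (rule poly_roots_finite)
    from sub fin show "finite ?Z" by (rule finite_surj[rotated])
    have "card ?Z \<le> card ?R" using fin sub by (rule surj_card_le)
    also have "\<dots> \<le> degree q" using card_poly_roots_bound[OF \<open>u y \<noteq> 0\<close>] deg[of y] by linarith
    finally show "card ?Z \<le> degree q" .
  qed
qed

proposition curve_length_real_preimage_le:
  fixes q :: "complex poly"
  assumes "degree q > 0" and \<gamma>: "path \<gamma>" "path_image \<gamma> \<subseteq> cball 0 1"
    and inj: "inj_on \<gamma> {0..1}" and real: "\<And>t. t \<in> {0..1} \<Longrightarrow> Im (poly q (\<gamma> t)) = 0"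
  shows "curve_length \<gamma> \<le> ennreal (pi * degree q)"
proof (rule curve_length_le_Crofton[OF \<gamma>])
  fix \<theta>
  obtain B where B: "finite B"
    "\<And>y. y \<notin> B \<Longrightarrow> finite {z. Im (poly q z) = 0 \<and> Re (cnj (cis \<theta>) * z) = y}"
    "\<And>y. y \<notin> B \<Longrightarrow> card {z. Im (poly q z) = 0 \<and> Re (cnj (cis \<theta>) * z) = y} \<le> degree q"
    by (rule line_meets_real_preimage_finitely[OF assms(1), where \<theta> = \<theta>]) (rule that)
  have "finite {t\<in>{0..1}. Re (cnj (cis \<theta>) * \<gamma> t) = y} \<and>
      card {t\<in>{0..1}. Re (cnj (cis \<theta>) * \<gamma> t) = y} \<le> degree q" if "y \<notin> B" for y
  proof -
    let ?A = "{t\<in>{0..1}. Re (cnj (cis \<theta>) * \<gamma> t) = y}"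
      and ?Z = "{z. Im (poly q z) = 0 \<and> Re (cnj (cis \<theta>) * z) = y}"
    have "inj_on \<gamma> ?A" using inj by (rule inj_on_subset) auto
    moreover have "\<gamma> ` ?A \<subseteq> ?Z" using real by auto
    ultimately show ?thesis
      using B(2,3)[OF that] card_inj_on_le[of \<gamma> ?A ?Z] inj_on_finite[of \<gamma> ?A ?Z] by linarith
  qed
  then show "\<exists>B. finite B \<and> (\<forall>y. y \<notin> B \<longrightarrow>
      finite {t\<in>{0..1}. Re (cnj (cis \<theta>) * \<gamma> t) = y} \<and>
      card {t\<in>{0..1}. Re (cnj (cis \<theta>) * \<gamma> t) = y} \<le> degree q)"
    using B(1) by blast
qed

section \<open>Escaping from the disc\<close>

lemma dist_le_norm_reflected_factor:
  fixes a z :: complex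
  assumes "cmod a \<le> 1" "cmod z \<le> 1"
  shows "cmod (z - a) \<le> cmod (1 - cnj a * z)"
proof -
  have "(cmod (1 - cnj a * z))\<^sup>2 - (cmod (z - a))\<^sup>2 = (1 - (cmod a)\<^sup>2) * (1 - (cmod z)\<^sup>2)"
    unfolding cmod_power2 by (simp add: power2_eq_square algebra_simps)
  also have "\<dots> \<ge> 0" using assms by (intro mult_nonneg_nonneg) (auto simp: power_le_one)
  finally have "(cmod (z - a))\<^sup>2 \<le> (cmod (1 - cnj a * z))\<^sup>2" by simp
  then show ?thesis by (rule power2_le_imp_le) simp
qed

text \<open>
  Lift the segment from \<open>1\<close> to \<open>0\<close> through \<open>q\<close> and stop where the lift first meets the unit circle.
  Up to there \<open>|f| \<le> |q| \<le> 1\<close>, and the values of \<open>q\<close>, which are real and pairwise distinct, make the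
  path an injective one to which the length bound applies.
\<close>

lemma escape_path_of_reflected_poly:
  fixes q :: "complex poly"
  assumes deg: "degree q > 0" and q0: "poly q 0 = 1"
    and nz: "\<And>z. poly q z = 0 \<Longrightarrow> cmod z \<ge> 1"
    and dom: "\<And>z. cmod z \<le> 1 \<Longrightarrow> cmod (poly f z) \<le> cmod (poly q z)"
  shows "\<exists>\<gamma>\<in>escape_paths f. curve_length \<gamma> \<le> ennreal (pi * degree q)"
proof -
  define w where "w t = complex_of_real (1 - t)" for t :: real
  have "path w" by (simp add: path_def w_def continuous_intros)
  then obtain z where z: "path z" "z 0 = 0" "\<And>t. t \<in> {0..1} \<Longrightarrow> poly q (z t) = w t"
    using poly_lift_path[OF deg, of w 0] q0 by (auto simp: w_def)
  have "poly q (z 1) = 0" using z(3)[of 1] by (simp add: w_def)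
  then have outside: "pathfinish z \<notin> ball 0 1" using nz by (fastforce simp: pathfinish_def)
  have inside: "pathstart z \<in> closure (ball 0 1)" using z(2) by (simp add: pathstart_def)
  obtain u where u: "0 \<le> u" "u \<le> 1" "z u \<in> frontier (ball 0 1)"
    "path_image (subpath 0 u z) - {z u} \<subseteq> interior (ball 0 1)"
    by (rule subpath_to_frontier[OF z(1) inside outside])
  have u0: "u > 0" using u(1,3) z(2) by (cases "u = 0") auto
  define \<gamma> where "\<gamma> = subpath 0 u z"
  have \<gamma>: "path \<gamma>" unfolding \<gamma>_def using z(1) u(1,2) by (intro path_subpath) auto
  have q\<gamma>: "poly q (\<gamma> t) = complex_of_real (1 - u * t) \<and> u * t \<in> {0..1}" if "t \<in> {0..1}" for t
  proof -
    have "u * t \<in> {0..1}" using that u(1,2) by (auto intro: mult_le_one)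
    then show ?thesis using z(3)[of "u * t"] by (simp add: \<gamma>_def subpath_def w_def)
  qed
  have disc: "path_image \<gamma> \<subseteq> cball 0 1"
    using u(3,4) by (fastforce simp: \<gamma>_def)
  have inj: "inj_on \<gamma> {0..1}"
  proof (rule inj_onI)
    fix s t :: real assume "s \<in> {0..1}" "t \<in> {0..1}" "\<gamma> s = \<gamma> t"
    then have "complex_of_real (1 - u * s) = complex_of_real (1 - u * t)"
      using q\<gamma> by metis
    then show "s = t" using u0 by simp
  qed
  have len: "curve_length \<gamma> \<le> ennreal (pi * degree q)"
    by (rule curve_length_real_preimage_le[OF deg \<gamma> disc inj]) (simp add: q\<gamma>)
  have "path_image \<gamma> \<subseteq> disc_lemniscate f"
  proof
    fix x assume "x \<in> path_image \<gamma>"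
    then obtain t where t: "t \<in> {0..1}" "x = \<gamma> t" by (auto simp: path_image_def)
    have x: "cmod x \<le> 1" using disc \<open>x \<in> path_image \<gamma>\<close> by auto
    have "cmod (poly q x) \<le> 1" using q\<gamma>[OF t(1)] t(2) by (simp only: norm_of_real) auto
    then show "x \<in> disc_lemniscate f" using x dom[OF x] by (simp add: disc_lemniscate_def)
  qed
  moreover have "pathstart \<gamma> = 0" "pathfinish \<gamma> \<in> sphere 0 1"
    using z(2) u(3) by (simp_all add: \<gamma>_def)
  moreover have "curve_length \<gamma> < top" using len by (simp add: le_less_trans)
  ultimately have "\<gamma> \<in> escape_paths f" using \<gamma> by (simp add: escape_paths_def rectifiable_path_def)
  then show ?thesis using len by blast
qed

theorem proposition9p7:
  fixes n :: nat
  assumes "n \<ge> 1"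
  shows "S n \<le> ennreal (pi * real n)"
  unfolding S_def
proof (rule SUP_least)
  fix f assume "f \<in> disc_polys n"
  then obtain a where f: "f = (\<Prod>j=1..n. [:- a j, 1:])" and a: "\<And>j. j \<in> {1..n} \<Longrightarrow> cmod (a j) \<le> 1"
    by (auto simp: disc_polys_def)
  define q where "q = (\<Prod>j=1..n. [:1, - cnj (a j):])"
  have val: "poly q z = (\<Prod>j=1..n. 1 - cnj (a j) * z)" for z
    by (simp add: q_def poly_prod algebra_simps)
  have dom: "cmod (poly f z) \<le> cmod (poly q z)" if "cmod z \<le> 1" for z
  proof -
    have "cmod (poly f z) = (\<Prod>j=1..n. cmod (z - a j))"
      by (simp add: f poly_prod prod_norm algebra_simps)
    also have "\<dots> \<le> (\<Prod>j=1..n. cmod (1 - cnj (a j) * z))"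
      using a that by (intro prod_mono conjI dist_le_norm_reflected_factor) auto
    also have "\<dots> = cmod (poly q z)" by (simp add: val prod_norm)
    finally show ?thesis .
  qed
  have nz: "cmod z \<ge> 1" if zero: "poly q z = 0" for z
  proof -
    obtain j where j: "j \<in> {1..n}" "cnj (a j) * z = 1"
      using zero by (auto simp: val prod_zero_iff)
    then have "1 = cmod (a j) * cmod z" by (metis complex_mod_cnj norm_mult norm_one)
    also have "\<dots> \<le> 1 * cmod z" using a[OF j(1)] by (intro mult_right_mono) auto
    finally show ?thesis by simp
  qed
  have q0: "poly q 0 = 1" by (simp add: val)
  have degq: "degree q \<le> n"
  proof -
    have "degree q \<le> (\<Sum>j=1..n. degree [:1, - cnj (a j):])"
      using degree_prod_sum_le[of "{1..n}" "\<lambda>j. [:1, - cnj (a j):]"] by (simp add: q_def o_def)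
    also have "\<dots> \<le> (\<Sum>j=1..n. 1)" by (intro sum_mono) simp
    finally show ?thesis by simp
  qed
  have "\<exists>\<gamma>\<in>escape_paths f. curve_length \<gamma> \<le> ennreal (pi * n)"
  proof (cases "degree q > 0")
    case True
    have "ennreal (pi * degree q) \<le> ennreal (pi * n)" using degq by (intro ennreal_leI) simp
    with escape_path_of_reflected_poly[OF True q0 nz dom] show ?thesis by (meson order_trans)
  next
    case False
    then obtain c where "q = [:c:]" using degree_eq_zeroE by blast
    \<comment> \<open>here all \<open>a j\<close> vanish and \<open>|f| \<le> 1\<close> on the whole disc, so a radius will do\<close>
    with q0 have q1: "poly q z = 1" for z by simp
    have len: "curve_length (linepath 0 (1::complex)) \<le> ennreal 1"
      using curve_length_linepath_le[of 0 "1::complex"] by simp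
    have "path_image (linepath 0 1) \<subseteq> cball (0::complex) 1"
      by (simp add: closed_segment_subset)
    then have "path_image (linepath 0 1) \<subseteq> disc_lemniscate f"
      using dom q1 by (fastforce simp: disc_lemniscate_def)
    moreover have "curve_length (linepath 0 (1::complex)) < top" using len by (rule le_less_trans) simp
    ultimately have "linepath 0 1 \<in> escape_paths f"
      by (simp add: escape_paths_def rectifiable_path_def)
    moreover have "(1::real) \<le> pi * n"
      using mult_mono[of 1 pi 1 "real n"] pi_gt3 assms by simp
    then have "ennreal 1 \<le> ennreal (pi * n)" by (rule ennreal_leI)
    ultimately show ?thesis using len by (meson order_trans)
  qed
  then show "(INF \<gamma>\<in>escape_paths f. curve_length \<gamma>) \<le> ennreal (pi * n)"
    by (meson INF_lower order_trans)
qed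

end
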